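(* Let three finite points $\hat{\mathbf x}_1,\hat{\mathbf x}_2,\hat{\mathbf x}_3$ and two lines $\mathbf l_1,\mathbf l_2$ of $\mathrm P\mathbb R^2$ be in general position. If there exist two of the three points lying on the two lines respectively (i.e. one of them lies on $\mathbf l_1$ and the other lies on $\mathbf l_2$), then the problem of determining a non-degenerate conic $\mathbf C$ such that $\hat{\mathbf x}_i^T\mathbf C\hat{\mathbf x}_i=0$ for $i=1,2,3$ and $\mathbf l_j^T\mathbf C^{-1}\mathbf l_j=0$ for $j=1,2$ has a unique real solution.
   Context: $\mathrm P\mathbb R^2$ is the real projective plane. A hat denotes a finite point in normalized homogeneous coordinates, i.e. a vector of $\mathbb R^3$ whose third component is $1$. A line is given by a nonzero vector $\mathbf l\in\mathbb R^3$ (up to scale), and $\mathbf x$ lies on $\mathbf l$ iff $\mathbf x^T\mathbf l=0$; the two lines are distinct. A side of a triangle is the full line through two of its vertices. Three points and two lines are in general position if the three points are non-collinear, neither $\mathbf l_1$ nor $\mathbf l_2$ is a side of the triangle $\hat{\mathbf x}_1\hat{\mathbf x}_2\hat{\mathbf x}_3$, and the intersection point of $\mathbf l_1$ and $\mathbf l_2$ is not a vertex of that triangle. A conic is a nonzero symmetric $3\times3$ matrix (complex entries allowed) up to nonzero scale; it is non-degenerate if its determinant is nonzero and real if it can be represented by a real matrix. "Unique real solution" means that there is exactly one real non-degenerate conic (up to scale) satisfying the conditions. *)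

theory Defs
  imports "HOL-Analysis.Analysis"
begin

text \<open>
  Points and lines of the real projective plane are given by nonzero homogeneous
  coordinate vectors in \<open>real ^ 3\<close>.
\<close>

definition finite_point :: "real ^ 3 \<Rightarrow> bool" where
  "finite_point x \<longleftrightarrow> x $ 3 = 1"

definition on_line :: "real ^ 3 \<Rightarrow> real ^ 3 \<Rightarrow> bool" where
  "on_line x l \<longleftrightarrow> x \<bullet> l = 0"

definition same_line :: "real ^ 3 \<Rightarrow> real ^ 3 \<Rightarrow> bool" where
  "same_line l m \<longleftrightarrow> (\<exists>c. c \<noteq> 0 \<and> m = c *\<^sub>R l)"

text \<open>
  Collinearity in the projective sense; the library's \<open>collinear\<close> is affine
  collinearity of the coordinate vectors.
\<close>

definition collinear_points :: "(3 \<Rightarrow> real ^ 3) \<Rightarrow> bool" where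
  "collinear_points x \<longleftrightarrow> (\<exists>l. l \<noteq> 0 \<and> (\<forall>i. on_line (x i) l))"

definition is_side :: "real ^ 3 \<Rightarrow> (3 \<Rightarrow> real ^ 3) \<Rightarrow> bool" where
  "is_side l x \<longleftrightarrow> (\<exists>i j. i \<noteq> j \<and> on_line (x i) l \<and> on_line (x j) l)"

text \<open>
  For distinct lines the intersection point is unique, so it is a vertex precisely if
  some vertex lies on both lines.
\<close>

definition general_position ::
    "(3 \<Rightarrow> real ^ 3) \<Rightarrow> real ^ 3 \<Rightarrow> real ^ 3 \<Rightarrow> bool" where
  "general_position x l1 l2 \<longleftrightarrow>
     \<not> collinear_points x \<and> \<not> is_side l1 x \<and> \<not> is_side l2 x \<and>
     \<not> (\<exists>i. on_line (x i) l1 \<and> on_line (x i) l2)"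

definition cvec :: "real ^ 'n \<Rightarrow> complex ^ 'n" where
  "cvec v = (\<chi> i. complex_of_real (v $ i))"

definition cmat :: "real ^ 'n ^ 'm \<Rightarrow> complex ^ 'n ^ 'm" where
  "cmat A = (\<chi> i j. complex_of_real (A $ i $ j))"

text \<open>
  The value \<open>v\<^sup>T A v\<close>, without conjugation; the inner product \<open>\<bullet>\<close> on
  \<open>complex ^ 'n\<close> is a different, real-valued form.
\<close>

definition quad_form :: "complex ^ 'n ^ 'n \<Rightarrow> complex ^ 'n \<Rightarrow> complex" where
  "quad_form A v = (\<Sum>i\<in>UNIV. v $ i * (A *v v) $ i)"

text \<open>Conics are represented by matrices, with \<open>same_conic\<close> as their equality.\<close>

definition is_conic :: "complex ^ 3 ^ 3 \<Rightarrow> bool" where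
  "is_conic C \<longleftrightarrow> C \<noteq> 0 \<and> transpose C = C"

definition same_conic :: "complex ^ 3 ^ 3 \<Rightarrow> complex ^ 3 ^ 3 \<Rightarrow> bool" where
  "same_conic C D \<longleftrightarrow> (\<exists>c. c \<noteq> 0 \<and> D = (\<chi> i j. c * C $ i $ j))"

definition nondegenerate :: "complex ^ 3 ^ 3 \<Rightarrow> bool" where
  "nondegenerate C \<longleftrightarrow> det C \<noteq> 0"

definition real_conic :: "complex ^ 3 ^ 3 \<Rightarrow> bool" where
  "real_conic C \<longleftrightarrow> (\<exists>R :: real ^ 3 ^ 3. same_conic C (cmat R))"

definition conic_solution ::
    "(3 \<Rightarrow> real ^ 3) \<Rightarrow> real ^ 3 \<Rightarrow> real ^ 3 \<Rightarrow> complex ^ 3 ^ 3 \<Rightarrow> bool" where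
  "conic_solution x l1 l2 C \<longleftrightarrow>
     is_conic C \<and> nondegenerate C \<and>
     (\<forall>i. quad_form C (cvec (x i)) = 0) \<and>
     quad_form (matrix_inv C) (cvec l1) = 0 \<and>
     quad_form (matrix_inv C) (cvec l2) = 0"

end

theory Submission
  imports Defs
begin

text \<open>
  Say that the \<open>i\<close>-th point lies on \<open>l1\<close>, the \<open>j\<close>-th on \<open>l2\<close>, and let \<open>k\<close> be the remaining
  index. A non-degenerate conic touching a line and passing through a point of that line touches
  it exactly at that point, so the problem prescribes two points with their tangents, and a third
  point. These conditions are linear in the conic, although tangency to a line is quadratic in general.

  Take the three points as the vertices of the coordinate triangle
  (\<open>frame\<close>). The conics through them are then the symmetric matrices with zero diagonal and
  off-diagonal entries \<open>a\<close>, \<open>b\<close>, \<open>c\<close> (\<open>circumconic\<close>), of determinant \<open>2abc\<close>; the lines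
  become \<open>(0, p, q)\<close> and \<open>(r, 0, s)\<close>, and \<open>p\<close>, \<open>q\<close>, \<open>r\<close>, \<open>s\<close> are all nonzero because neither
  line is a side. The values of the dual form at these lines are nonzero multiples of the
  squares \<open>(bp - aq)\<^sup>2\<close> and \<open>(cr - as)\<^sup>2\<close> (\<open>dual_circumconic\<close>). The perfect squares are the
  algebraic trace of the fixed points of contact: each condition has one double root instead
  of two roots. Hence the conics sought are those with
  \<open>a : b : c = pr : qr : ps\<close> (\<open>conic_solution_iff\<close>), a single ratio, which is real and has
  no zero entry.
\<close>

section \<open>Change of projective coordinates\<close>

lemma matrix_inv_eqI:
  fixes A B :: "'a::field ^ 'n ^ 'n"
  assumes "A ** B = mat 1"
  shows "matrix_inv A = B"
proof -
  have BA: "B ** A = mat 1"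
    using assms by (simp add: matrix_left_right_inverse)
  have "\<exists>A'. A ** A' = mat 1 \<and> A' ** A = mat 1"
    using assms BA by blast
  then have "A ** matrix_inv A = mat 1"
    unfolding matrix_inv_def by (rule someI2_ex) simp
  then have "(B ** A) ** matrix_inv A = B"
    by (simp flip: matrix_mul_assoc)
  then show ?thesis by (simp add: BA)
qed

lemma matrix_inv_inverse:
  fixes A :: "'a::field ^ 'n ^ 'n"
  assumes "invertible A"
  shows "A ** matrix_inv A = mat 1" and "matrix_inv A ** A = mat 1"
  using assms matrix_inv_eqI unfolding invertible_def by metis+

lemma quad_form_congruence:
  "quad_form (transpose P ** A ** P) v = quad_form A (P *v v)"
proof -
  have dot: "(\<Sum>i\<in>UNIV. v $ i * (transpose P *v w) $ i) = (\<Sum>i\<in>UNIV. (P *v v) $ i * w $ i)" for w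
  proof -
    have "(\<Sum>i\<in>UNIV. v $ i * (transpose P *v w) $ i) =
          (\<Sum>i\<in>UNIV. \<Sum>j\<in>UNIV. v $ i * (P $ j $ i * w $ j))"
      by (simp add: matrix_vector_mult_def transpose_def sum_distrib_left del: transpose_matrix_vector)
    also have "\<dots> = (\<Sum>j\<in>UNIV. \<Sum>i\<in>UNIV. v $ i * (P $ j $ i * w $ j))"
      by (rule sum.swap)
    finally show ?thesis
      unfolding matrix_vector_mult_def by (simp add: sum_distrib_right) (simp add: mult_ac)
  qed
  show ?thesis
    unfolding quad_form_def
    by (simp add: dot del: transpose_matrix_vector flip: matrix_vector_mul_assoc)
qed

text \<open>
  Points transform by \<open>P\<close>, lines contragrediently; this invariance is what lets the tangency
  conditions be checked in coordinates adapted to the triangle.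
\<close>

lemma dual_quad_form_congruence:
  fixes P A :: "complex ^ 'n ^ 'n"
  assumes "invertible P" and "invertible A"
  shows "quad_form (matrix_inv (transpose P ** A ** P)) (transpose P *v l) =
         quad_form (matrix_inv A) l"
proof -
  define Q where "Q = matrix_inv P"
  have PQ: "P ** Q = mat 1" and QP: "Q ** P = mat 1"
    unfolding Q_def by (simp_all add: matrix_inv_inverse assms(1))
  have tPQ: "transpose P ** transpose Q = mat 1" "transpose Q ** transpose P = mat 1"
    using QP PQ by (metis matrix_transpose_mul transpose_mat)+
  have "(transpose P ** A ** P) ** (Q ** matrix_inv A ** transpose Q) =
        transpose P ** (A ** (P ** Q) ** matrix_inv A) ** transpose Q"
    by (simp add: matrix_mul_assoc)
  also have "\<dots> = mat 1"
    using assms(2) by (simp add: PQ tPQ matrix_inv_inverse)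
  finally have "matrix_inv (transpose P ** A ** P) = transpose (transpose Q) ** matrix_inv A ** transpose Q"
    by (simp add: matrix_inv_eqI)
  then show ?thesis
    by (simp only: quad_form_congruence) (simp add: matrix_vector_mul_assoc tPQ del: transpose_matrix_vector)
qed

text \<open>
  Read from right to left this builds a conic with prescribed coordinate matrix; read from left
  to right it shows that the coordinate matrix determines the conic.
\<close>

lemma congruence_cancel:
  fixes P :: "'a::field ^ 'n ^ 'n"
  assumes "invertible P"
  shows "transpose P ** A ** P = B \<longleftrightarrow>
         A = transpose (matrix_inv P) ** B ** matrix_inv P"
proof -
  define Q where "Q = matrix_inv P"
  have PQ: "P ** Q = mat 1" and QP: "Q ** P = mat 1"
    unfolding Q_def by (simp_all add: matrix_inv_inverse assms)
  have tPQ: "transpose P ** transpose Q = mat 1" "transpose Q ** transpose P = mat 1"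
    using QP PQ by (metis matrix_transpose_mul transpose_mat)+
  have 1: "transpose Q ** (transpose P ** X ** P) ** Q = X" for X
  proof -
    have "transpose Q ** (transpose P ** X ** P) ** Q =
          (transpose Q ** transpose P) ** X ** (P ** Q)"
      by (simp add: matrix_mul_assoc)
    then show ?thesis by (simp add: PQ tPQ)
  qed
  have 2: "transpose P ** (transpose Q ** X ** Q) ** P = X" for X
  proof -
    have "transpose P ** (transpose Q ** X ** Q) ** P =
          (transpose P ** transpose Q) ** X ** (Q ** P)"
      by (simp add: matrix_mul_assoc)
    then show ?thesis by (simp add: QP tPQ)
  qed
  show ?thesis using 1 2 unfolding Q_def by metis
qed

lemma scale_congruence:
  fixes P :: "'a::comm_semiring_1 ^ 'n ^ 'n"
  shows "transpose P ** (\<chi> i j. h * A $ i $ j) ** P =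
         (\<chi> i j. h * (transpose P ** A ** P) $ i $ j)"
proof -
  have "X ** (\<chi> i j. h * A $ i $ j) = (\<chi> i j. h * (X ** A) $ i $ j)"
    and "(\<chi> i j. h * A $ i $ j) ** X = (\<chi> i j. h * (A ** X) $ i $ j)"
    for X A :: "'a ^ 'n ^ 'n"
    by (simp_all add: matrix_matrix_mult_def vec_eq_iff sum_distrib_left mult.left_commute mult.assoc)
  then show ?thesis by simp
qed

lemma transpose_congruence:
  fixes P :: "'a::field ^ 'n ^ 'n"
  assumes "invertible P"
  shows "transpose (transpose P ** A ** P) = transpose P ** A ** P \<longleftrightarrow> transpose A = A"
proof -
  have "transpose (transpose P ** A ** P) = transpose P ** transpose A ** P"
    by (simp add: matrix_transpose_mul matrix_mul_assoc)
  then show ?thesis using congruence_cancel[OF assms] by metis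
qed

section \<open>Complexification of real matrices\<close>

lemma cmat_mult: "cmat (A ** B) = cmat A ** cmat B"
  by (simp add: cmat_def matrix_matrix_mult_def vec_eq_iff)

lemma cmat_mult_cvec: "cmat A *v cvec v = cvec (A *v v)"
  by (simp add: cmat_def cvec_def matrix_vector_mult_def vec_eq_iff)

lemma cmat_transpose: "cmat (transpose A) = transpose (cmat A)"
  by (simp add: cmat_def transpose_def vec_eq_iff)

lemma cmat_mat_1: "cmat (mat 1) = mat 1"
  by (simp add: cmat_def mat_def vec_eq_iff)

lemma cmat_inverse:
  fixes A :: "real ^ 'n ^ 'n"
  assumes "invertible A"
  shows "invertible (cmat A)" and "matrix_inv (cmat A) = cmat (matrix_inv A)"
proof -
  have "cmat A ** cmat (matrix_inv A) = mat 1" "cmat (matrix_inv A) ** cmat A = mat 1"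
    using assms by (simp_all add: matrix_inv_inverse cmat_mat_1 flip: cmat_mult)
  then show "invertible (cmat A)" "matrix_inv (cmat A) = cmat (matrix_inv A)"
    by (auto simp: invertible_def intro: matrix_inv_eqI)
qed

section \<open>Conics through the vertices of the coordinate triangle\<close>

definition circumconic :: "'a::comm_ring_1 \<Rightarrow> 'a \<Rightarrow> 'a \<Rightarrow> 'a ^ 3 ^ 3" where
  "circumconic a b c = vector [vector [0, a, b], vector [a, 0, c], vector [b, c, 0]]"

lemma circumconic_iff:
  "(\<exists>a b c. A = circumconic a b c) \<longleftrightarrow>
   transpose A = A \<and> A $ 1 $ 1 = 0 \<and> A $ 2 $ 2 = 0 \<and> A $ 3 $ 3 = 0"
proof
  assume "\<exists>a b c. A = circumconic a b c"
  then show "transpose A = A \<and> A $ 1 $ 1 = 0 \<and> A $ 2 $ 2 = 0 \<and> A $ 3 $ 3 = 0"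
    by (elim exE) (simp add: circumconic_def transpose_def vec_eq_iff forall_3)
next
  assume A: "transpose A = A \<and> A $ 1 $ 1 = 0 \<and> A $ 2 $ 2 = 0 \<and> A $ 3 $ 3 = 0"
  have "A $ m $ n = A $ n $ m" for m n
  proof -
    have "transpose A $ m $ n = A $ m $ n" using A by simp
    then show ?thesis by (simp add: transpose_def)
  qed
  from this[of 2 1] this[of 3 1] this[of 3 2]
  have "A = circumconic (A $ 1 $ 2) (A $ 1 $ 3) (A $ 2 $ 3)"
    using A by (simp add: circumconic_def vec_eq_iff forall_3)
  then show "\<exists>a b c. A = circumconic a b c" by blast
qed

lemma det_circumconic: "det (circumconic a b c) = 2 * a * b * c"
  by (simp add: det_3 circumconic_def algebra_simps)

text \<open>
  The lines \<open>(0, p, q)\<close> and \<open>(r, 0, s)\<close> are those through the first and through the second vertex.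
  A line meets the conic in two points that coincide precisely when the dual form vanishes; since
  one of the two is already the vertex, the value of the dual form is, up to a nonzero factor,
  the square of a linear form in \<open>a\<close>, \<open>b\<close>, \<open>c\<close>.
\<close>

lemma dual_circumconic:
  assumes "a \<noteq> 0" "b \<noteq> 0" "c \<noteq> 0"
  shows "quad_form (matrix_inv (circumconic a b c)) (vector [0, p, q]) =
           - (b * p - a * q)\<^sup>2 / (2 * a * b * c)"
    and "quad_form (matrix_inv (circumconic a b c)) (vector [r, 0, s]) =
           - (c * r - a * s)\<^sup>2 / (2 * a * b * c)"
proof -
  \<comment> \<open>the adjugate divided by the determinant \<open>2abc\<close>\<close>
  define J :: "complex ^ 3 ^ 3" where
    "J = vector [vector [- c / (2*a*b), 1 / (2*a), 1 / (2*b)],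
                 vector [1 / (2*a), - b / (2*a*c), 1 / (2*c)],
                 vector [1 / (2*b), 1 / (2*c), - a / (2*b*c)]]"
  have "circumconic a b c ** J = mat 1"
    using assms by (simp add: J_def circumconic_def matrix_matrix_mult_def mat_def vec_eq_iff
        forall_3 sum_3 field_simps)
  then have J: "matrix_inv (circumconic a b c) = J"
    by (rule matrix_inv_eqI)
  show "quad_form (matrix_inv (circumconic a b c)) (vector [0, p, q]) =
           - (b * p - a * q)\<^sup>2 / (2 * a * b * c)"
    using assms unfolding J
    by (simp add: J_def quad_form_def matrix_vector_mult_def sum_3 power2_eq_square field_simps)
  show "quad_form (matrix_inv (circumconic a b c)) (vector [r, 0, s]) =
           - (c * r - a * s)\<^sup>2 / (2 * a * b * c)"
    using assms unfolding J
    by (simp add: J_def quad_form_def matrix_vector_mult_def sum_3 power2_eq_square field_simps)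
qed

section \<open>Reduction to the coordinate triangle\<close>

definition frame :: "'a::zero ^ 3 \<Rightarrow> 'a ^ 3 \<Rightarrow> 'a ^ 3 \<Rightarrow> 'a ^ 3 ^ 3" where
  "frame u v w = transpose (vector [u, v, w])"

lemma transpose_frame_mult:
  "transpose (frame u v w) *v l = vector [u \<bullet> l, v \<bullet> l, w \<bullet> l]"
  by (simp add: frame_def matrix_vector_mult_def inner_vec_def vec_eq_iff forall_3)

lemma frame_mult_axis:
  fixes u v w :: "'a::comm_semiring_1 ^ 3"
  shows "frame u v w *v axis 1 1 = u" "frame u v w *v axis 2 1 = v" "frame u v w *v axis 3 1 = w"
  by (simp_all add: frame_def matrix_vector_mult_def transpose_def axis_def vec_eq_iff forall_3 sum_3)

lemma quad_form_axis: "quad_form A (axis i 1) = A $ i $ i"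
  by (simp add: quad_form_def matrix_vector_mult_def axis_def if_distrib if_distribR cong: if_cong)

text \<open>
  A line whose coordinates are killed by the transposed frame passes through all three points.
\<close>

lemma frame_invertible:
  assumes "\<not> collinear_points x" and "UNIV = {i, j, k}"
  shows "invertible (frame (x i) (x j) (x k))"
proof -
  have "l = 0" if "transpose (frame (x i) (x j) (x k)) *v l = 0" for l
  proof (rule ccontr)
    assume "l \<noteq> 0"
    have "x i \<bullet> l = 0" "x j \<bullet> l = 0" "x k \<bullet> l = 0"
      using that by (auto simp: transpose_frame_mult vec_eq_iff forall_3 simp del: transpose_matrix_vector)
    then have "on_line (x m) l" for m
      using assms(2) unfolding on_line_def by (metis UNIV_I empty_iff insertE)
    then show False
      using \<open>l \<noteq> 0\<close> assms(1) unfolding collinear_points_def by blast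
  qed
  then have "\<exists>B. B ** transpose (frame (x i) (x j) (x k)) = mat 1"
    unfolding matrix_left_invertible_ker by blast
  then have "invertible (transpose (frame (x i) (x j) (x k)))"
    by (simp add: invertible_left_inverse)
  then show ?thesis
    using transpose_invertible by fastforce
qed

text \<open>
  In the coordinates of the triangle the problem becomes linear. Incidence makes
  \<open>x i \<bullet> l1\<close> and \<open>x j \<bullet> l2\<close> vanish, so that both lines have the shape required by
  \<open>dual_circumconic\<close>; non-degeneracy amounts to \<open>a\<close>, \<open>b\<close>, \<open>c\<close> all being nonzero.
\<close>

lemma conic_solution_iff:
  fixes x :: "3 \<Rightarrow> real ^ 3" and l1 l2 :: "real ^ 3"
  assumes ijk: "UNIV = {i, j, k}" and nc: "\<not> collinear_points x"
    and on: "on_line (x i) l1" "on_line (x j) l2"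
  defines "P \<equiv> cmat (frame (x i) (x j) (x k))"
  shows "conic_solution x l1 l2 C \<longleftrightarrow>
     (\<exists>a b c. a \<noteq> 0 \<and> b \<noteq> 0 \<and> c \<noteq> 0 \<and> transpose P ** C ** P = circumconic a b c \<and>
        b * (x j \<bullet> l1) = a * (x k \<bullet> l1) \<and> c * (x i \<bullet> l2) = a * (x k \<bullet> l2))"
proof -
  define F where "F = frame (x i) (x j) (x k)"
  define A where "A = transpose P ** C ** P"
  have invP: "invertible P"
    unfolding P_def using frame_invertible[OF nc ijk] by (rule cmat_inverse)
  then have detP: "det P \<noteq> 0" by (simp add: invertible_det_nz)
  have detA: "det A = (det P)\<^sup>2 * det C"
    by (simp add: A_def det_mul det_transpose power2_eq_square)
  have sym: "transpose A = A \<longleftrightarrow> transpose C = C"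
    unfolding A_def by (rule transpose_congruence[OF invP])
  have all: "(\<forall>m. R m) \<longleftrightarrow> R i \<and> R j \<and> R k" for R :: "3 \<Rightarrow> bool"
    using ijk by (metis UNIV_I empty_iff insertE)
  have Paxis: "P *v axis m 1 = cvec (F *v axis m 1)" for m
  proof -
    have "axis m 1 = cvec (axis m (1::real))"
      by (simp add: cvec_def axis_def vec_eq_iff)
    then show ?thesis by (simp add: P_def F_def cmat_mult_cvec)
  qed
  have diag: "A $ m $ m = quad_form C (cvec (F *v axis m 1))" for m
    unfolding A_def by (simp flip: quad_form_axis add: quad_form_congruence Paxis)
  have pts: "(\<forall>m. quad_form C (cvec (x m)) = 0) \<longleftrightarrow>
      A $ 1 $ 1 = 0 \<and> A $ 2 $ 2 = 0 \<and> A $ 3 $ 3 = 0"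
    unfolding all[of "\<lambda>m. quad_form C (cvec (x m)) = 0"] diag F_def frame_mult_axis ..
  have cv: "cvec (vector [u, v, w] :: real ^ 3) = vector [of_real u, of_real v, of_real w]" for u v w :: real
    by (simp add: cvec_def vec_eq_iff forall_3)
  have lines: "transpose P *v cvec l = vector [x i \<bullet> l, x j \<bullet> l, x k \<bullet> l]" for l
    by (simp add: P_def cmat_mult_cvec transpose_frame_mult cv flip: cmat_transpose
        del: transpose_matrix_vector)
  have dual: "quad_form (matrix_inv C) (cvec l) = 
      quad_form (matrix_inv A) (vector [x i \<bullet> l, x j \<bullet> l, x k \<bullet> l])"
    if "det C \<noteq> 0" for l
    using dual_quad_form_congruence[OF invP, of C "cvec l"] that
    by (simp add: invertible_det_nz lines A_def del: transpose_matrix_vector)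
  have tan: "quad_form (matrix_inv C) (cvec l1) = 0 \<longleftrightarrow> b * (x j \<bullet> l1) = a * (x k \<bullet> l1)"
    "quad_form (matrix_inv C) (cvec l2) = 0 \<longleftrightarrow> c * (x i \<bullet> l2) = a * (x k \<bullet> l2)"
    if "det C \<noteq> 0" "A = circumconic a b c" "a \<noteq> 0" "b \<noteq> 0" "c \<noteq> 0" for a b c
    using that on by (simp_all add: dual dual_circumconic on_line_def)
  show ?thesis
  proof
    assume sol: "conic_solution x l1 l2 C"
    then have "det C \<noteq> 0" "\<exists>a b c. A = circumconic a b c"
      unfolding circumconic_iff sym
      by (auto simp: conic_solution_def nondegenerate_def is_conic_def pts)
    then obtain a b c where A: "A = circumconic a b c" by blast
    then have "a \<noteq> 0" "b \<noteq> 0" "c \<noteq> 0"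
      using \<open>det C \<noteq> 0\<close> detA detP det_circumconic[of a b c] by auto
    then show "\<exists>a b c. a \<noteq> 0 \<and> b \<noteq> 0 \<and> c \<noteq> 0 \<and> transpose P ** C ** P = circumconic a b c \<and>
        b * (x j \<bullet> l1) = a * (x k \<bullet> l1) \<and> c * (x i \<bullet> l2) = a * (x k \<bullet> l2)"
      using A tan[OF \<open>det C \<noteq> 0\<close> A] sol unfolding A_def conic_solution_def by blast
  next
    assume "\<exists>a b c. a \<noteq> 0 \<and> b \<noteq> 0 \<and> c \<noteq> 0 \<and> transpose P ** C ** P = circumconic a b c \<and>
        b * (x j \<bullet> l1) = a * (x k \<bullet> l1) \<and> c * (x i \<bullet> l2) = a * (x k \<bullet> l2)"
    then obtain a b c where nz: "a \<noteq> 0" "b \<noteq> 0" "c \<noteq> 0" and A: "A = circumconic a b c"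
      and t: "b * (x j \<bullet> l1) = a * (x k \<bullet> l1)" "c * (x i \<bullet> l2) = a * (x k \<bullet> l2)"
      unfolding A_def by blast
    have C: "det C \<noteq> 0"
      using detA nz det_circumconic[of a b c] A by auto
    then have "C \<noteq> 0"
      by (auto simp: det_3)
    moreover have "transpose C = C \<and> (\<forall>m. quad_form C (cvec (x m)) = 0)"
      using A circumconic_iff[of A] unfolding sym pts by blast
    ultimately show "conic_solution x l1 l2 C"
      using C tan[OF C A nz] t by (simp add: conic_solution_def is_conic_def nondegenerate_def)
  qed
qed

theorem theorem5:
  fixes x :: "3 \<Rightarrow> real ^ 3" and l1 l2 :: "real ^ 3"
  assumes "\<forall>i. finite_point (x i)"
    and "l1 \<noteq> 0" and "l2 \<noteq> 0" and "\<not> same_line l1 l2"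
    and "general_position x l1 l2"
    and "\<exists>i j. i \<noteq> j \<and> on_line (x i) l1 \<and> on_line (x j) l2"
  shows "\<exists>C. conic_solution x l1 l2 C \<and> real_conic C \<and>
           (\<forall>D. conic_solution x l1 l2 D \<and> real_conic D \<longrightarrow> same_conic C D)"
proof -
  obtain i j where "i \<noteq> j" and on: "on_line (x i) l1" "on_line (x j) l2"
    using assms(6) by blast
  then obtain k where ijk: "UNIV = {i, j, k}" and "k \<noteq> i" "k \<noteq> j"
  proof -
    have "card {i, j} < CARD(3)"
      using \<open>i \<noteq> j\<close> by simp
    then have "{i, j} \<noteq> UNIV"
      by auto
    then obtain k where k: "k \<noteq> i" "k \<noteq> j"
      by blast
    then have "card {i, j, k} = CARD(3)"
      using \<open>i \<noteq> j\<close> by simp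
    then have "{i, j, k} = UNIV"
      by (intro card_subset_eq) auto
    then show ?thesis using that k by blast
  qed
  have nc: "\<not> collinear_points x"
    using assms(5) by (simp add: general_position_def)
  define p where "p = x j \<bullet> l1"
  define q where "q = x k \<bullet> l1"
  define r where "r = x i \<bullet> l2"
  define s where "s = x k \<bullet> l2"
  have nz: "p \<noteq> 0" "q \<noteq> 0" "r \<noteq> 0" "s \<noteq> 0"
    using assms(5) on \<open>i \<noteq> j\<close> \<open>k \<noteq> i\<close> \<open>k \<noteq> j\<close>
    unfolding p_def q_def r_def s_def general_position_def is_side_def on_line_def by metis+
  define F where "F = frame (x i) (x j) (x k)"
  have invF: "invertible F"
    unfolding F_def by (rule frame_invertible[OF nc ijk])
  note invP = cmat_inverse(1)[OF invF]
  \<comment> \<open>the equations \<open>b * p = a * q\<close> and \<open>c * r = a * s\<close>, solved without denominators\<close>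
  define R where
    "R = transpose (matrix_inv F) ** circumconic (p * r) (q * r) (p * s) ** matrix_inv F"
  define V :: "complex ^ 3 ^ 3" where "V = circumconic (p * r) (q * r) (p * s)"
  have "transpose F ** R ** F = circumconic (p * r) (q * r) (p * s)"
    using congruence_cancel[OF invF] R_def by blast
  then have "cmat (transpose F ** R ** F) = cmat (circumconic (p * r) (q * r) (p * s))"
    by simp
  also have "\<dots> = V"
    by (simp add: V_def cmat_def circumconic_def vec_eq_iff forall_3)
  finally have V: "transpose (cmat F) ** cmat R ** cmat F = V"
    by (simp add: cmat_mult cmat_transpose)
  have sol: "conic_solution x l1 l2 (cmat R)"
    unfolding conic_solution_iff[OF ijk nc on] F_def[symmetric] V
    unfolding V_def p_def[symmetric] q_def[symmetric] r_def[symmetric] s_def[symmetric]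
    using nz
    by (intro exI[of _ "of_real p * of_real r"] exI[of _ "of_real q * of_real r"]
        exI[of _ "of_real p * of_real s"]) (simp add: mult_ac)
  have "same_conic (cmat R) (cmat R)"
    unfolding same_conic_def by (intro exI[of _ 1]) simp
  then have real: "real_conic (cmat R)"
    unfolding real_conic_def by blast
  have "same_conic (cmat R) D" if D_sol: "conic_solution x l1 l2 D" for D
  proof -
    obtain a b c where abc: "a \<noteq> 0"
      and D: "transpose (cmat F) ** D ** cmat F = circumconic a b c"
      and t: "b * p = a * q" "c * r = a * s"
      using D_sol unfolding conic_solution_iff[OF ijk nc on] F_def p_def q_def r_def s_def by blast
    \<comment> \<open>the scale factor is forced by the first of the three entries\<close>
    define h where "h = a / (p * r)"
    have "h \<noteq> 0" using abc nz by (simp add: h_def)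
    have h: "h * (p * r) = a" "h * (q * r) = b" "h * (p * s) = c"
    proof -
      show "h * (p * r) = a"
        using nz by (simp add: h_def)
      have "h * (q * r) = a * q / p"
        using nz by (simp add: h_def)
      then show "h * (q * r) = b"
        using nz by (simp flip: t(1))
      have "h * (p * s) = a * s / r"
        using nz by (simp add: h_def)
      then show "h * (p * s) = c"
        using nz by (simp flip: t(2))
    qed
    define E where "E = (\<chi> m n. h * cmat R $ m $ n)"
    have "transpose (cmat F) ** E ** cmat F = (\<chi> m n. h * (transpose (cmat F) ** cmat R ** cmat F) $ m $ n)"
      unfolding E_def by (rule scale_congruence)
    also have "\<dots> = circumconic a b c"
      using h unfolding V by (simp add: V_def circumconic_def vec_eq_iff forall_3)
    finally have "D = E"
      using D unfolding congruence_cancel[OF invP] by simp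
    then show ?thesis
      unfolding same_conic_def E_def using \<open>h \<noteq> 0\<close> by blast
  qed
  then show ?thesis using sol real by blast
qed

end
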